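(* Suppose that $(PF)(x)\ge F(x)$ for all $x\in\mathbf X$, and that there exist constants $L\in\mathbb R$, $C<\infty$ and $\rho\in(0,1)$ such that $\sup_{x\in\mathbf X}|(P^tF)(x)-L|\le C\rho^t$ for all $t\in\mathbb N_0$. Let $\gamma\in(0,1)$ be given. If $k^\star_\gamma(x)=\infty$ for some $x\in\mathbf X$, then the always-$n$ policy $\varphi^n$, defined by $\varphi^n(y,k)=n$ for all $(y,k)\in\mathbf S$, is $\gamma$-discounted optimal, i.e., $V^{\varphi^n}_\gamma(y,k)=V_\gamma(y,k)$ for all $y\in\mathbf X$ and $k\ge0$.
   Context: Setting. $\mathbf X$ is a Borel space, $P$ is a stochastic (Markov) kernel on $\mathbf X$ given $\mathbf X$, $\nu$ is a probability measure on $\mathbf X$, $F:\mathbf X\to[0,\infty]$ is measurable, and $G(n),G(r)\in[0,\infty)$ are constants. $\mathbb N_0=\{0,1,2,\dots\}$. $P^k$ is the $k$-fold composition of $P$ ($P^0$ is the identity kernel) and $(P^kF)(x)=\int_{\mathbf X}F(y)P^k(dy\mid x)$. The MDP $\{\mathbf S,\mathbf A,Q,c\}$ (the fully observed reduction of the Restart POMDP) has state space $\mathbf S=\mathbf X\times\mathbb N_0$ (last observed state, time elapsed since last restart), action space $\mathbf A=\{n,r\}$ ($n$: no intervention, $r$: restart), transition kernel $Q(dx'\times dk'\mid(x,k),n)=\delta_x(dx')\delta_{k+1}(dk')$, $Q(dx'\times dk'\mid(x,k),r)=\nu(dx')\delta_0(dk')$, and one-step cost $c(x,k;a)=(P^kF)(x)+G(a)$.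 A policy $\pi=\{\pi_t\}_{t\ge0}$ is a sequence of stochastic kernels $\pi_t$ on $\mathbf A$ given $(\mathbf S\times\mathbf A)^t\times\mathbf S$ (randomized, history-dependent); a deterministic stationary policy is identified with a measurable map $\varphi:\mathbf S\to\mathbf A$ (action $\varphi(s_t)$ is used at each time $t$). $\mathsf E^\pi_{x,k}$ is the expectation for the process $\{(S_t,A_t)\}$ of states and actions under $\pi$ started at $(x,k)$. For $\gamma\in(0,1)$, $V^\pi_\gamma(x,k)=\mathsf E^\pi_{x,k}\big[\sum_{t\ge0}\gamma^t c(S_t,A_t)\big]$ and $V_\gamma(x,k)=\inf_\pi V^\pi_\gamma(x,k)$. Threshold index: with $V_{0,\gamma}=\int_{\mathbf X}V_\gamma(z,0)\,\nu(dz)$ and $A(\gamma)=G(r)+\gamma V_{0,\gamma}$, $$k^\star_\gamma(x)=\inf\{k\in\mathbb N_0: A(\gamma)\le G(n)+\gamma V_\gamma(x,k+1)\}\in\mathbb N_0\cup\{\infty\},\qquad \inf\emptyset=\infty.$$ *)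

theory Defs
  imports "HOL-Probability.Probability"
begin

datatype action = NoInt | Restart

text \<open>
  A Borel space is a Borel subset \<open>X\<close> of a Polish space, carrying the trace of the Borel
  sigma-algebra.
\<close>

locale restart_mdp =
  fixes X :: "'a::polish_space set"
    and P :: "'a \<Rightarrow> 'a measure"
    and \<nu> :: "'a measure"
    and F :: "'a \<Rightarrow> ennreal"
    and G :: "action \<Rightarrow> real"
  assumes X_borel: "X \<in> sets borel"
    and P_kernel: "P \<in> restrict_space borel X \<rightarrow>\<^sub>M prob_algebra (restrict_space borel X)"
    and nu_prob: "\<nu> \<in> space (prob_algebra (restrict_space borel X))"
    and F_measurable: "F \<in> borel_measurable (restrict_space borel X)"
    and G_nonneg: "\<And>a. 0 \<le> G a"
begin

abbreviation MX :: "'a measure" where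
  "MX \<equiv> restrict_space borel X"

abbreviation MS :: "('a \<times> nat) measure" where
  "MS \<equiv> MX \<Otimes>\<^sub>M count_space UNIV"

abbreviation MA :: "action measure" where
  "MA \<equiv> count_space UNIV"

abbreviation MSA :: "(('a \<times> nat) \<times> action) measure" where
  "MSA \<equiv> MS \<Otimes>\<^sub>M MA"

primrec kernel_pow :: "nat \<Rightarrow> 'a \<Rightarrow> 'a measure" where
  "kernel_pow 0 x = return MX x"
| "kernel_pow (Suc k) x = kernel_pow k x \<bind> P"

definition PF :: "nat \<Rightarrow> 'a \<Rightarrow> ennreal" where
  "PF k x = (\<integral>\<^sup>+ y. F y \<partial>kernel_pow k x)"

definition Q :: "'a \<times> nat \<Rightarrow> action \<Rightarrow> ('a \<times> nat) measure" where
  "Q s a = (case (s, a) of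
     ((x, k), NoInt) \<Rightarrow> return MX x \<Otimes>\<^sub>M return (count_space UNIV) (k + 1)
   | ((x, k), Restart) \<Rightarrow> \<nu> \<Otimes>\<^sub>M return (count_space UNIV) 0)"

definition cost :: "'a \<times> nat \<Rightarrow> action \<Rightarrow> ennreal" where
  "cost s a = PF (snd s) (fst s) + ennreal (G a)"

text \<open>
  The decision rule at time \<open>t\<close> receives the past state-action pairs, as a function on
  \<open>{0..<t}\<close>, together with the current state.
\<close>

definition policy :: "(nat \<Rightarrow> (nat \<Rightarrow> ('a \<times> nat) \<times> action) \<times> ('a \<times> nat) \<Rightarrow> action measure) \<Rightarrow> bool"
  where "policy \<pi> \<longleftrightarrow> (\<forall>t. \<pi> t \<in> PiM {0..<t} (\<lambda>_. MSA) \<Otimes>\<^sub>M MS \<rightarrow>\<^sub>M prob_algebra MA)"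

definition stationary ::
  "('a \<times> nat \<Rightarrow> action) \<Rightarrow> nat \<Rightarrow> (nat \<Rightarrow> ('a \<times> nat) \<times> action) \<times> ('a \<times> nat) \<Rightarrow> action measure"
  where "stationary \<phi> t = (\<lambda>(h, s). return MA (\<phi> s))"

text \<open>
  Conditional law of \<open>(S\<^sub>t, A\<^sub>t)\<close> given the pairs before time \<open>t\<close>, for the process started in \<open>s\<^sub>0\<close>;
  the law of the whole process is then obtained from the Ionescu-Tulcea theorem.
\<close>

definition state_kernel ::
  "'a \<times> nat \<Rightarrow> nat \<Rightarrow> (nat \<Rightarrow> ('a \<times> nat) \<times> action) \<Rightarrow> ('a \<times> nat) measure" where
  "state_kernel s\<^sub>0 t h =
     (case t of 0 \<Rightarrow> return MS s\<^sub>0 | Suc u \<Rightarrow> Q (fst (h u)) (snd (h u)))"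

definition step_kernel ::
  "(nat \<Rightarrow> (nat \<Rightarrow> ('a \<times> nat) \<times> action) \<times> ('a \<times> nat) \<Rightarrow> action measure) \<Rightarrow> 'a \<times> nat \<Rightarrow>
   nat \<Rightarrow> (nat \<Rightarrow> ('a \<times> nat) \<times> action) \<Rightarrow> (('a \<times> nat) \<times> action) measure" where
  "step_kernel \<pi> s\<^sub>0 t h =
     state_kernel s\<^sub>0 t h \<bind> (\<lambda>s. \<pi> t (h, s) \<bind> (\<lambda>a. return MSA (s, a)))"

definition process_law ::
  "(nat \<Rightarrow> (nat \<Rightarrow> ('a \<times> nat) \<times> action) \<times> ('a \<times> nat) \<Rightarrow> action measure) \<Rightarrow> 'a \<times> nat \<Rightarrow>
   (nat \<Rightarrow> ('a \<times> nat) \<times> action) measure" where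
  "process_law \<pi> s\<^sub>0 =
     projective_family.lim UNIV (Ionescu_Tulcea.CI (step_kernel \<pi> s\<^sub>0) (\<lambda>_. MSA)) (\<lambda>_. MSA)"

definition policy_value ::
  "real \<Rightarrow> (nat \<Rightarrow> (nat \<Rightarrow> ('a \<times> nat) \<times> action) \<times> ('a \<times> nat) \<Rightarrow> action measure) \<Rightarrow>
   'a \<times> nat \<Rightarrow> ennreal" where
  "policy_value \<gamma> \<pi> s\<^sub>0 =
     (\<integral>\<^sup>+ \<omega>. (\<Sum>t. ennreal (\<gamma> ^ t) * cost (fst (\<omega> t)) (snd (\<omega> t))) \<partial>process_law \<pi> s\<^sub>0)"

definition opt_value :: "real \<Rightarrow> 'a \<times> nat \<Rightarrow> ennreal" where
  "opt_value \<gamma> s\<^sub>0 = (INF \<pi>\<in>{\<pi>. policy \<pi>}. policy_value \<gamma> \<pi> s\<^sub>0)"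

definition restart_value :: "real \<Rightarrow> ennreal" where
  "restart_value \<gamma> = ennreal (G Restart) + ennreal \<gamma> * (\<integral>\<^sup>+ z. opt_value \<gamma> (z, 0) \<partial>\<nu>)"

definition threshold :: "real \<Rightarrow> 'a \<Rightarrow> enat" where
  "threshold \<gamma> x =
     Inf (enat ` {k. restart_value \<gamma> \<le> ennreal (G NoInt) + ennreal \<gamma> * opt_value \<gamma> (x, k + 1)})"

lemma policy_stationary:
  assumes [measurable]: "\<phi> \<in> MS \<rightarrow>\<^sub>M MA"
  shows "policy (stationary \<phi>)"
  unfolding policy_def stationary_def
  by (intro allI measurable_prob_algebraI)
     (auto simp: split_beta intro!: prob_space_return measurable_compose[OF _ return_measurable])

lemma pair_return_nat:
  assumes [measurable_cong]: "sets N = sets MX"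
  shows "N \<Otimes>\<^sub>M return (count_space UNIV) j = distr N MS (\<lambda>x. (x, j))"
proof (rule measure_eqI)
  show "sets (N \<Otimes>\<^sub>M return (count_space UNIV) j) = sets (distr N MS (\<lambda>x. (x, j)))"
    by (simp add: sets_pair_measure_cong[OF assms])
next
  fix B assume "B \<in> sets (N \<Otimes>\<^sub>M return (count_space UNIV) j)"
  moreover have "sets (N \<Otimes>\<^sub>M return (count_space UNIV) j) = sets MS"
    by (intro sets_pair_measure_cong) (auto simp: assms)
  ultimately have B[measurable]: "B \<in> sets MS" and B': "B \<in> sets (N \<Otimes>\<^sub>M return (count_space UNIV) j)"
    by auto
  interpret R: prob_space "return (count_space UNIV) j"
    by (rule prob_space_return) simp
  have "emeasure (N \<Otimes>\<^sub>M return (count_space UNIV) j) B =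
      (\<integral>\<^sup>+ x. indicator ((\<lambda>x. (x, j)) -` B \<inter> space N) x \<partial>N)"
    by (subst R.emeasure_pair_measure_alt[OF B'])
       (auto intro!: nn_integral_cong split: split_indicator simp del: nn_integral_indicator)
  also have "\<dots> = emeasure (distr N MS (\<lambda>x. (x, j))) B"
    by (subst nn_integral_indicator) (auto simp: emeasure_distr)
  finally show "emeasure (N \<Otimes>\<^sub>M return (count_space UNIV) j) B = emeasure (distr N MS (\<lambda>x. (x, j))) B" .
qed

lemma Q_NoInt:
  assumes "s \<in> space MS"
  shows "Q s NoInt = return MS (fst s, snd s + 1)"
proof -
  obtain x k where s: "s = (x, k)"
    by (cases s)
  have "x \<in> space MX"
    using assms by (simp add: s space_pair_measure)
  then show ?thesis
    by (simp add: Q_def s pair_return_nat) (subst distr_return; simp)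
qed

lemma Q_Restart: "Q s Restart = distr \<nu> MS (\<lambda>x. (x, 0))"
  using nu_prob by (simp add: Q_def space_prob_algebra pair_return_nat split: prod.split)

lemma measurable_Q: "(\<lambda>p. Q (fst p) (snd p)) \<in> MSA \<rightarrow>\<^sub>M prob_algebra MS"
proof -
  have nu: "sets \<nu> = sets MX" "prob_space \<nu>"
    using nu_prob by (auto simp: space_prob_algebra)
  note [measurable_cong] = nu(1)
  have "distr \<nu> MS (\<lambda>x. (x, 0)) \<in> space (prob_algebra MS)"
    by (auto simp: space_prob_algebra intro!: prob_space.prob_space_distr nu)
  then have R: "(\<lambda>p. distr \<nu> MS (\<lambda>x. (x, 0))) \<in> MSA \<rightarrow>\<^sub>M prob_algebra MS"
    by (intro measurable_const)
  have N: "(\<lambda>p. return MS (fst (fst p), snd (fst p) + 1)) \<in> MSA \<rightarrow>\<^sub>M prob_algebra MS"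
    by (rule measurable_compose[OF _ measurable_return_prob_space]) measurable
  have "(\<lambda>p. if snd p = NoInt then return MS (fst (fst p), snd (fst p) + 1)
      else distr \<nu> MS (\<lambda>x. (x, 0))) \<in> MSA \<rightarrow>\<^sub>M prob_algebra MS"
    by (intro measurable_If N R) measurable
  then show ?thesis
  proof (rule measurable_cong[THEN iffD1, rotated])
    fix p assume "p \<in> space MSA"
    then show "(if snd p = NoInt then return MS (fst (fst p), snd (fst p) + 1)
      else distr \<nu> MS (\<lambda>x. (x, 0))) = Q (fst p) (snd p)"
      by (cases "snd p") (auto simp: Q_NoInt Q_Restart space_pair_measure)
  qed
qed

lemma measurable_state_kernel:
  assumes "s\<^sub>0 \<in> space MS"
  shows "state_kernel s\<^sub>0 t \<in> PiM {0..<t} (\<lambda>_. MSA) \<rightarrow>\<^sub>M prob_algebra MS"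
proof (cases t)
  case 0
  have "return MS s\<^sub>0 \<in> space (prob_algebra MS)"
    using assms by (auto simp: space_prob_algebra intro!: prob_space_return)
  then show ?thesis
    by (simp add: 0 state_kernel_def[abs_def])
next
  case (Suc u)
  have "(\<lambda>h. h u) \<in> PiM {0..<t} (\<lambda>_. MSA) \<rightarrow>\<^sub>M MSA"
    using Suc by (intro measurable_component_singleton) simp
  from measurable_compose[OF this measurable_Q] show ?thesis
    by (simp add: Suc state_kernel_def[abs_def])
qed

lemma measurable_step_kernel:
  assumes "policy \<pi>" and "s\<^sub>0 \<in> space MS"
  shows "step_kernel \<pi> s\<^sub>0 t \<in> PiM {0..<t} (\<lambda>_. MSA) \<rightarrow>\<^sub>M prob_algebra MSA"
proof -
  have \<pi>: "\<pi> t \<in> PiM {0..<t} (\<lambda>_. MSA) \<Otimes>\<^sub>M MS \<rightarrow>\<^sub>M prob_algebra MA"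
    using assms(1) by (simp add: policy_def)
  have R: "(\<lambda>(p, a). return MSA (snd p, a)) \<in>
      (PiM {0..<t} (\<lambda>_. MSA) \<Otimes>\<^sub>M MS) \<Otimes>\<^sub>M MA \<rightarrow>\<^sub>M prob_algebra MSA"
    unfolding split_beta by (rule measurable_compose[OF _ measurable_return_prob_space]) measurable
  have "(\<lambda>p. \<pi> t p \<bind> (\<lambda>a. return MSA (snd p, a))) \<in>
      PiM {0..<t} (\<lambda>_. MSA) \<Otimes>\<^sub>M MS \<rightarrow>\<^sub>M prob_algebra MSA"
    by (rule measurable_bind_prob_space2[OF \<pi> R])
  then show ?thesis
    unfolding step_kernel_def[abs_def]
    by (intro measurable_bind_prob_space2[OF measurable_state_kernel[OF assms(2)]])
       (simp add: case_prod_beta')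
qed

lemma Ionescu_Tulcea_step_kernel:
  assumes "policy \<pi>" and "s\<^sub>0 \<in> space MS"
  shows "Ionescu_Tulcea (step_kernel \<pi> s\<^sub>0) (\<lambda>_. MSA)"
  unfolding Ionescu_Tulcea_def
proof (intro conjI allI impI)
  fix t :: nat
  show "step_kernel \<pi> s\<^sub>0 t \<in> PiM {0..<t} (\<lambda>_. MSA) \<rightarrow>\<^sub>M subprob_algebra MSA"
    by (rule measurable_prob_algebraD[OF measurable_step_kernel[OF assms]])
next
  fix t :: nat and h assume "h \<in> space (PiM {0..<t} (\<lambda>_. MSA))"
  from measurable_space[OF measurable_step_kernel[OF assms] this]
  show "prob_space (step_kernel \<pi> s\<^sub>0 t h)"
    by (simp add: space_prob_algebra)
qed

end

end

theory Submission
  imports Defs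
begin

text \<open>
  Value iteration from \<open>0\<close> increases to a limit \<open>v\<close> with \<open>T v \<le> v\<close>, where \<open>T\<close> is the Bellman operator.
  Every iterate is a lower bound for the cost of every policy, and the stationary policy that
  attains the minimum in \<open>T v\<close> costs at most \<open>v\<close>; hence \<open>v\<close> is the optimal value, which gives
  \<open>T V \<le> V\<close> (and the measurability of \<open>V\<close>).

  Let \<open>U(y, k) = (\<Sum>t. \<gamma>\<^sup>t (P\<^sup>k\<^sup>+\<^sup>tF(y) + G(n)))\<close> be the cost of never restarting. If along some \<open>x\<close>
  continuing always beats restarting, iterating \<open>T V \<le> V\<close> gives \<open>U(x, k) \<le> V(x, k)\<close> for all \<open>k\<close>.
  As \<open>P\<^sup>kF\<close> increases to \<open>L\<close> everywhere, \<open>U(x, k)\<close> tends to \<open>M = (L + G(n)) / (1 - \<gamma>)\<close>, so the restart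
  value is at least \<open>G(n) + \<gamma> M\<close>. But \<open>V \<le> U \<le> M\<close> on the whole state space, so continuing is at
  least as good as restarting everywhere, and the same iteration gives \<open>U \<le> V\<close>.
\<close>

section \<open>Limits and geometric series in the extended nonnegative reals\<close>

text \<open>Addition is continuous and the error term vanishes in the limit. Keeping errors as added
  terms avoids subtraction in \<open>ennreal\<close>; the rate is \<rho> for the convergence of
  \<open>PF\<close> and \<gamma> for discounting.\<close>

lemma ennreal_le_if_le_add_geometric:
  fixes u v :: ennreal and a r :: real
  assumes "0 \<le> r" "r < 1" and le: "\<And>m::nat. u \<le> v + ennreal (a * r ^ m)"
  shows "u \<le> v"
proof (rule LIMSEQ_le_const)
  have "(\<lambda>m. a * r ^ m) \<longlonglongrightarrow> a * 0"
    using assms by (intro tendsto_intros LIMSEQ_power_zero) simp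
  then have "(\<lambda>m. v + ennreal (a * r ^ m)) \<longlonglongrightarrow> v + ennreal (a * 0)"
    by (intro tendsto_add tendsto_const tendsto_ennrealI)
  then show "(\<lambda>m. v + ennreal (a * r ^ m)) \<longlonglongrightarrow> v"
    by simp
qed (use le in auto)

text \<open>\<open>ennreal\<close> cuts negative reals off at 0, so for summands of unknown sign
  only this direction holds. It is applied with \<open>L\<close>, whose sign is not given.\<close>

lemma ennreal_add_le: "ennreal (a + b) \<le> ennreal a + ennreal b"
proof -
  have "ennreal (a + b) \<le> ennreal (max 0 a + max 0 b)"
    by (intro ennreal_leI) auto
  then show ?thesis
    by (simp add: ennreal_plus)
qed

lemma suminf_geometric_ennreal:
  fixes \<gamma> b :: real
  assumes "0 \<le> \<gamma>" "\<gamma> < 1" "0 \<le> b"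
  shows "(\<Sum>t. ennreal (\<gamma> ^ t) * ennreal b) = ennreal (b / (1 - \<gamma>))"
proof -
  have "(\<lambda>t. \<gamma> ^ t * b) sums (1 / (1 - \<gamma>) * b)"
    using assms by (intro sums_mult2 geometric_sums) simp
  then have "(\<Sum>t. ennreal (\<gamma> ^ t * b)) = ennreal (1 / (1 - \<gamma>) * b)"
    using assms by (intro suminf_ennreal_eq) auto
  then show ?thesis
    using assms by (simp add: ennreal_mult)
qed

section \<open>Finite-dimensional marginals of the Ionescu-Tulcea limit\<close>

text \<open>The marginal of the limit on \<open>{0..<n}\<close> is \<open>CI {0..<n}\<close>, which
  is the \<open>n\<close>-fold kernel composition \<open>C 0 n\<close>. In this locale
  \<open>PF\<close> is the projective family and \<open>P\<close> the sequence of kernels, not the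
  objects of \<open>restart_mdp\<close>.\<close>

lemma (in Ionescu_Tulcea) nn_integral_lim_restrict:
  assumes f[measurable]: "f \<in> borel_measurable (PiM {0..<n} M)"
  shows "(\<integral>\<^sup>+ \<omega>. f (restrict \<omega> {0..<n}) \<partial>PF.lim) = (\<integral>\<^sup>+ h. f h \<partial>C 0 n (\<lambda>_. undefined))"
proof -
  have "up_to {0..<n} = n"
    unfolding up_to_def by (rule Least_equality) (auto simp: not_less_eq_eq intro!: leI)
  then have "(\<integral>\<^sup>+ h. f h \<partial>CI {0..<n}) =
      (\<integral>\<^sup>+ h. f (restrict h {0..<n}) \<partial>C 0 n (\<lambda>_. undefined))"
    unfolding CI_def
    by (subst nn_integral_distr) (auto simp: measurable_cong_sets[OF sets_C])
  also have "\<dots> = (\<integral>\<^sup>+ h. f h \<partial>C 0 n (\<lambda>_. undefined))"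
    using nn_integral_C[of n n f 0 "\<lambda>_. undefined"] by simp
  also have "(\<integral>\<^sup>+ h. f h \<partial>CI {0..<n}) = (\<integral>\<^sup>+ \<omega>. f (restrict \<omega> {0..<n}) \<partial>PF.lim)"
    by (subst distr_lim[symmetric], simp, subst nn_integral_distr)
       (auto simp: measurable_cong_sets[OF PF.sets_lim] intro!: measurable_restrict)
  finally show ?thesis .
qed

text \<open>The tower property: \<open>C 0 (Suc n)\<close> extends a history drawn from
  \<open>C 0 n\<close> by one coordinate drawn from \<open>P n\<close>.\<close>

lemma (in Ionescu_Tulcea) nn_integral_lim_coordinate:
  assumes f[measurable]: "f \<in> borel_measurable (M n)"
  shows "(\<integral>\<^sup>+ \<omega>. f (\<omega> n) \<partial>PF.lim) =
    (\<integral>\<^sup>+ \<omega>. (\<integral>\<^sup>+ x. f x \<partial>P n (restrict \<omega> {0..<n})) \<partial>PF.lim)"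
proof -
  have [measurable]: "(\<lambda>h. f (h n)) \<in> borel_measurable (PiM {0..<Suc n} M)"
    by measurable
  have K[measurable]: "(\<lambda>h. \<integral>\<^sup>+ x. f x \<partial>P n h) \<in> borel_measurable (PiM {0..<n} M)"
    by (rule measurable_compose[OF P nn_integral_measurable_subprob_algebra]) simp
  have "(\<integral>\<^sup>+ \<omega>. f (\<omega> n) \<partial>PF.lim) = (\<integral>\<^sup>+ h. f (h n) \<partial>C 0 (Suc n) (\<lambda>_. undefined))"
    using nn_integral_lim_restrict[of "\<lambda>h. f (h n)" "Suc n"] by simp
  also have "\<dots> = (\<integral>\<^sup>+ h. (\<integral>\<^sup>+ h'. f (h' n) \<partial>eP n h) \<partial>C 0 n (\<lambda>_. undefined))"
    using measurable_eP[of n]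
    by (simp add: nn_integral_bind[where B="PiM {0..<Suc n} M"] measurable_cong_sets[OF sets_C refl])
  also have "\<dots> = (\<integral>\<^sup>+ h. (\<integral>\<^sup>+ x. f x \<partial>P n h) \<partial>C 0 n (\<lambda>_. undefined))"
    by (intro nn_integral_cong) (simp add: space_C nn_integral_eP)
  also have "\<dots> = (\<integral>\<^sup>+ \<omega>. (\<integral>\<^sup>+ x. f x \<partial>P n (restrict \<omega> {0..<n})) \<partial>PF.lim)"
    by (rule nn_integral_lim_restrict[symmetric]) fact
  finally show ?thesis .
qed

context restart_mdp
begin

subsection \<open>One-step identities for the process law\<close>

lemma nu_sets[measurable_cong]: "sets \<nu> = sets MX" and nu_space: "space \<nu> = X"
  using nu_prob by (auto simp: space_prob_algebra space_restrict_space dest: sets_eq_imp_space_eq)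

lemma space_MS: "s \<in> space MS \<longleftrightarrow> fst s \<in> X"
  by (cases s) (auto simp: space_pair_measure space_restrict_space)

lemma process_law_sets:
  assumes "policy \<pi>" and "s\<^sub>0 \<in> space MS"
  shows "sets (process_law \<pi> s\<^sub>0) = sets (PiM UNIV (\<lambda>_. MSA))"
proof -
  interpret IT: Ionescu_Tulcea "step_kernel \<pi> s\<^sub>0" "\<lambda>_. MSA"
    by (rule Ionescu_Tulcea_step_kernel[OF assms])
  show ?thesis
    unfolding process_law_def by simp
qed

lemma process_law_space:
  assumes "policy \<pi>" and "s\<^sub>0 \<in> space MS"
  shows "\<omega> \<in> space (process_law \<pi> s\<^sub>0) \<Longrightarrow> \<omega> t \<in> space MSA"
  using sets_eq_imp_space_eq[OF process_law_sets[OF assms]] by (auto simp: space_PiM)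

lemma measurable_process_coordinate:
  assumes "policy \<pi>" and "s\<^sub>0 \<in> space MS"
  shows "(\<lambda>\<omega>. \<omega> t) \<in> process_law \<pi> s\<^sub>0 \<rightarrow>\<^sub>M MSA"
  unfolding measurable_cong_sets[OF process_law_sets[OF assms] refl] by simp

text \<open>Resolves both binds in \<open>step_kernel\<close>: first the state is drawn given the
  history, then the action given history and state.\<close>

lemma nn_integral_process_coordinate:
  assumes pol: "policy \<pi>" and s0: "s\<^sub>0 \<in> space MS" and f[measurable]: "f \<in> borel_measurable MSA"
  shows "(\<integral>\<^sup>+ \<omega>. f (\<omega> t) \<partial>process_law \<pi> s\<^sub>0) =
    (\<integral>\<^sup>+ \<omega>. (\<integral>\<^sup>+ s. (\<integral>\<^sup>+ a. f (s, a) \<partial>\<pi> t (restrict \<omega> {0..<t}, s))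
      \<partial>state_kernel s\<^sub>0 t (restrict \<omega> {0..<t})) \<partial>process_law \<pi> s\<^sub>0)"
proof -
  interpret IT: Ionescu_Tulcea "step_kernel \<pi> s\<^sub>0" "\<lambda>_. MSA"
    by (rule Ionescu_Tulcea_step_kernel[OF pol s0])
  have step: "(\<integral>\<^sup>+ x. f x \<partial>step_kernel \<pi> s\<^sub>0 t h) =
      (\<integral>\<^sup>+ s. (\<integral>\<^sup>+ a. f (s, a) \<partial>\<pi> t (h, s)) \<partial>state_kernel s\<^sub>0 t h)"
    if h[measurable]: "h \<in> space (PiM {0..<t} (\<lambda>_. MSA))" for h
  proof -
    have \<pi>: "\<pi> t \<in> PiM {0..<t} (\<lambda>_. MSA) \<Otimes>\<^sub>M MS \<rightarrow>\<^sub>M prob_algebra MA"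
      using pol by (simp add: policy_def)
    have sk: "state_kernel s\<^sub>0 t h \<in> space (prob_algebra MS)"
      using measurable_space[OF measurable_state_kernel[OF s0] h] .
    then have sk_sets[measurable_cong]: "sets (state_kernel s\<^sub>0 t h) = sets MS"
      by (simp add: space_prob_algebra)
    have \<pi>h: "(\<lambda>s. \<pi> t (h, s)) \<in> MS \<rightarrow>\<^sub>M prob_algebra MA"
      by (rule measurable_compose[OF _ \<pi>]) (rule measurable_Pair1'[OF h])
    have R: "(\<lambda>(s, a). return MSA (s, a)) \<in> MS \<Otimes>\<^sub>M MA \<rightarrow>\<^sub>M prob_algebra MSA"
      by (simp add: measurable_return_prob_space)
    have N: "(\<lambda>s. \<pi> t (h, s) \<bind> (\<lambda>a. return MSA (s, a))) \<in> MS \<rightarrow>\<^sub>M prob_algebra MSA"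
      by (rule measurable_bind_prob_space2[OF \<pi>h R])
    have "(\<integral>\<^sup>+ x. f x \<partial>step_kernel \<pi> s\<^sub>0 t h) =
        (\<integral>\<^sup>+ s. (\<integral>\<^sup>+ x. f x \<partial>(\<pi> t (h, s) \<bind> (\<lambda>a. return MSA (s, a)))) \<partial>state_kernel s\<^sub>0 t h)"
      unfolding step_kernel_def
      by (rule nn_integral_bind[OF f])
         (use measurable_prob_algebraD[OF N] in \<open>simp add: measurable_cong_sets[OF sk_sets refl]\<close>)
    also have "\<dots> = (\<integral>\<^sup>+ s. (\<integral>\<^sup>+ a. f (s, a) \<partial>\<pi> t (h, s)) \<partial>state_kernel s\<^sub>0 t h)"
    proof (intro nn_integral_cong)
      fix s assume "s \<in> space (state_kernel s\<^sub>0 t h)"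
      then have s: "s \<in> space MS"
        by (simp add: sets_eq_imp_space_eq[OF sk_sets])
      have "\<pi> t (h, s) \<in> space (prob_algebra MA)"
        by (rule measurable_space[OF \<pi>h s])
      then have \<pi>s: "sets (\<pi> t (h, s)) = sets MA"
        by (simp add: space_prob_algebra)
      have "(\<lambda>a. return MSA (s, a)) \<in> MA \<rightarrow>\<^sub>M subprob_algebra MSA"
        by (rule measurable_compose[OF measurable_Pair1'[OF s] return_measurable])
      then have "(\<integral>\<^sup>+ x. f x \<partial>(\<pi> t (h, s) \<bind> (\<lambda>a. return MSA (s, a)))) =
          (\<integral>\<^sup>+ a. (\<integral>\<^sup>+ x. f x \<partial>return MSA (s, a)) \<partial>\<pi> t (h, s))"
        by (intro nn_integral_bind[OF f]) (simp add: measurable_cong_sets[OF \<pi>s refl])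
      also have "\<dots> = (\<integral>\<^sup>+ a. f (s, a) \<partial>\<pi> t (h, s))"
        by (intro nn_integral_cong nn_integral_return) (use s in \<open>auto simp: space_pair_measure\<close>)
      finally show "(\<integral>\<^sup>+ x. f x \<partial>(\<pi> t (h, s) \<bind> (\<lambda>a. return MSA (s, a)))) = \<dots>" .
    qed
    finally show ?thesis .
  qed
  show ?thesis
    unfolding process_law_def
    by (subst IT.nn_integral_lim_coordinate[OF f], intro nn_integral_cong step)
       (auto simp: space_PiM PiE_iff)
qed

text \<open>The integrand ignores the action, and the action kernel has mass one.\<close>

lemma nn_integral_process_state:
  assumes pol: "policy \<pi>" and s0: "s\<^sub>0 \<in> space MS" and g[measurable]: "g \<in> borel_measurable MS"
  shows "(\<integral>\<^sup>+ \<omega>. g (fst (\<omega> t)) \<partial>process_law \<pi> s\<^sub>0) =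
    (\<integral>\<^sup>+ \<omega>. (\<integral>\<^sup>+ s. g s \<partial>state_kernel s\<^sub>0 t (restrict \<omega> {0..<t})) \<partial>process_law \<pi> s\<^sub>0)"
proof -
  have \<pi>: "\<pi> t \<in> PiM {0..<t} (\<lambda>_. MSA) \<Otimes>\<^sub>M MS \<rightarrow>\<^sub>M prob_algebra MA"
    using pol by (simp add: policy_def)
  have "(\<integral>\<^sup>+ \<omega>. g (fst (\<omega> t)) \<partial>process_law \<pi> s\<^sub>0) =
    (\<integral>\<^sup>+ \<omega>. (\<integral>\<^sup>+ s. (\<integral>\<^sup>+ a. g (fst (s, a)) \<partial>\<pi> t (restrict \<omega> {0..<t}, s))
      \<partial>state_kernel s\<^sub>0 t (restrict \<omega> {0..<t})) \<partial>process_law \<pi> s\<^sub>0)"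
    by (rule nn_integral_process_coordinate[OF pol s0]) measurable
  also have "\<dots> = (\<integral>\<^sup>+ \<omega>. (\<integral>\<^sup>+ s. g s \<partial>state_kernel s\<^sub>0 t (restrict \<omega> {0..<t})) \<partial>process_law \<pi> s\<^sub>0)"
  proof (intro nn_integral_cong)
    fix \<omega> s assume \<omega>: "\<omega> \<in> space (process_law \<pi> s\<^sub>0)"
      and s: "s \<in> space (state_kernel s\<^sub>0 t (restrict \<omega> {0..<t}))"
    have h: "restrict \<omega> {0..<t} \<in> space (PiM {0..<t} (\<lambda>_. MSA))"
      using process_law_space[OF pol s0 \<omega>] by (auto simp: space_PiM)
    have "state_kernel s\<^sub>0 t (restrict \<omega> {0..<t}) \<in> space (prob_algebra MS)"
      by (rule measurable_space[OF measurable_state_kernel[OF s0] h])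
    then have "s \<in> space MS"
      using s by (auto simp: space_prob_algebra dest: sets_eq_imp_space_eq)
    with h have "(restrict \<omega> {0..<t}, s) \<in> space (PiM {0..<t} (\<lambda>_. MSA) \<Otimes>\<^sub>M MS)"
      by (simp add: space_pair_measure)
    from measurable_space[OF \<pi> this]
    interpret prob_space "\<pi> t (restrict \<omega> {0..<t}, s)"
      by (simp add: space_prob_algebra)
    show "(\<integral>\<^sup>+ a. g (fst (s, a)) \<partial>\<pi> t (restrict \<omega> {0..<t}, s)) = g s"
      by (simp add: emeasure_space_1)
  qed
  finally show ?thesis .
qed

lemma nn_integral_process_state_0:
  assumes pol: "policy \<pi>" and s0: "s\<^sub>0 \<in> space MS" and g: "g \<in> borel_measurable MS"
  shows "(\<integral>\<^sup>+ \<omega>. g (fst (\<omega> 0)) \<partial>process_law \<pi> s\<^sub>0) = g s\<^sub>0"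
proof -
  interpret IT: Ionescu_Tulcea "step_kernel \<pi> s\<^sub>0" "\<lambda>_. MSA"
    by (rule Ionescu_Tulcea_step_kernel[OF pol s0])
  \<comment> \<open>The total mass is read off from the marginal on the empty set of
    coordinates.\<close>
  have "emeasure (process_law \<pi> s\<^sub>0) (space (process_law \<pi> s\<^sub>0)) = 1"
    using IT.nn_integral_lim_restrict[of "\<lambda>_. 1" 0] unfolding process_law_def
    by (simp add: IT.prob_space_C[THEN prob_space.emeasure_space_1])
  then show ?thesis
    by (simp add: nn_integral_process_state[OF pol s0 g] state_kernel_def nn_integral_return[OF s0 g])
qed

lemma nn_integral_process_state_Suc:
  assumes pol: "policy \<pi>" and s0: "s\<^sub>0 \<in> space MS" and g: "g \<in> borel_measurable MS"
  shows "(\<integral>\<^sup>+ \<omega>. g (fst (\<omega> (Suc t))) \<partial>process_law \<pi> s\<^sub>0) =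
    (\<integral>\<^sup>+ \<omega>. (\<integral>\<^sup>+ s. g s \<partial>Q (fst (\<omega> t)) (snd (\<omega> t))) \<partial>process_law \<pi> s\<^sub>0)"
  by (simp add: nn_integral_process_state[OF pol s0 g] state_kernel_def)

text \<open>The action is drawn from a point mass at \<open>\<phi>\<close> of the current state, so
  it can be replaced by that value under the integral.\<close>

lemma nn_integral_process_stationary:
  assumes \<phi>[measurable]: "\<phi> \<in> MS \<rightarrow>\<^sub>M MA" and s0: "s\<^sub>0 \<in> space MS"
    and f[measurable]: "f \<in> borel_measurable MSA"
  shows "(\<integral>\<^sup>+ \<omega>. f (\<omega> t) \<partial>process_law (stationary \<phi>) s\<^sub>0) =
    (\<integral>\<^sup>+ \<omega>. f (fst (\<omega> t), \<phi> (fst (\<omega> t))) \<partial>process_law (stationary \<phi>) s\<^sub>0)"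
proof -
  note pol = policy_stationary[OF \<phi>]
  have "(\<lambda>s. f (s, \<phi> s)) \<in> borel_measurable MS"
    by measurable
  from nn_integral_process_state[OF pol s0 this] show ?thesis
    by (simp add: nn_integral_process_coordinate[OF pol s0 f] stationary_def nn_integral_return)
qed

subsection \<open>Measurability of costs and transitions\<close>

lemma measurable_kernel_pow: "kernel_pow k \<in> MX \<rightarrow>\<^sub>M prob_algebra MX"
proof (induction k)
  case 0
  then show ?case
    by (simp add: kernel_pow.simps(1)[abs_def] measurable_return_prob_space)
next
  case (Suc k)
  have "(\<lambda>x. kernel_pow k x \<bind> P) \<in> MX \<rightarrow>\<^sub>M prob_algebra MX"
    by (rule measurable_bind_prob_space[OF Suc P_kernel])
  then show ?case
    by simp
qed

lemma kernel_pow_sets: "x \<in> X \<Longrightarrow> sets (kernel_pow k x) = sets MX"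
  using measurable_space[OF measurable_kernel_pow, of x k]
  by (simp add: space_prob_algebra space_restrict_space)

lemma kernel_pow_space: "x \<in> X \<Longrightarrow> space (kernel_pow k x) = X"
  using sets_eq_imp_space_eq[OF kernel_pow_sets, of x k] by (simp add: space_restrict_space)

lemma measurable_PF: "PF k \<in> borel_measurable MX"
  unfolding PF_def[abs_def]
  by (rule measurable_compose[OF measurable_prob_algebraD[OF measurable_kernel_pow]
        nn_integral_measurable_subprob_algebra[OF F_measurable]])

text \<open>\<open>kernel_pow\<close> composes the new step last, so the one-step hypothesis on
  \<open>F\<close> can be applied inside the outer integral.\<close>

lemma PF_Suc:
  assumes "x \<in> X"
  shows "PF (Suc k) x = (\<integral>\<^sup>+ y. (\<integral>\<^sup>+ z. F z \<partial>P y) \<partial>kernel_pow k x)"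
  unfolding PF_def kernel_pow.simps
  by (rule nn_integral_bind[OF F_measurable])
     (use measurable_prob_algebraD[OF P_kernel] in
       \<open>simp add: measurable_cong_sets[OF kernel_pow_sets[OF assms] refl]\<close>)

lemma measurable_cost[measurable]: "(\<lambda>p. cost (fst p) (snd p)) \<in> borel_measurable MSA"
proof -
  \<comment> \<open>The elapsed time takes countably many values, so measurability for each fixed
    \<open>k\<close> suffices.\<close>
  have [measurable]: "(\<lambda>s. PF (snd s) (fst s)) \<in> borel_measurable MS"
  proof (rule measurable_compose_countable[of "\<lambda>k s. PF k (fst s)" MS borel snd])
    show "(\<lambda>s. PF k (fst s)) \<in> borel_measurable MS" for k
      by (rule measurable_compose[OF measurable_fst measurable_PF])
  qed measurable
  have [measurable]: "G \<in> borel_measurable MA"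
    by simp
  show ?thesis
    unfolding cost_def by measurable
qed

lemma measurable_nn_integral_Q:
  assumes "w \<in> borel_measurable MS"
  shows "(\<lambda>p. \<integral>\<^sup>+ s. w s \<partial>Q (fst p) (snd p)) \<in> borel_measurable MSA"
  by (rule measurable_compose[OF measurable_prob_algebraD[OF measurable_Q]
        nn_integral_measurable_subprob_algebra[OF assms]])

lemma nn_integral_Q_NoInt:
  assumes "w \<in> borel_measurable MS" and "s \<in> space MS"
  shows "(\<integral>\<^sup>+ s'. w s' \<partial>Q s NoInt) = w (fst s, Suc (snd s))"
  using assms by (simp add: Q_NoInt nn_integral_return space_MS)

lemma nn_integral_Q_Restart:
  assumes [measurable]: "w \<in> borel_measurable MS"
  shows "(\<integral>\<^sup>+ s'. w s' \<partial>Q s Restart) = (\<integral>\<^sup>+ z. w (z, 0) \<partial>\<nu>)"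
  unfolding Q_Restart by (subst nn_integral_distr) auto

subsection \<open>Bounds for policy values\<close>

lemma policy_value_suminf:
  assumes pol: "policy \<pi>" and s0: "s\<^sub>0 \<in> space MS"
  shows "policy_value \<gamma> \<pi> s\<^sub>0 =
    (\<Sum>t. ennreal (\<gamma> ^ t) * (\<integral>\<^sup>+ \<omega>. cost (fst (\<omega> t)) (snd (\<omega> t)) \<partial>process_law \<pi> s\<^sub>0))"
proof -
  have [measurable]: "(\<lambda>\<omega>. cost (fst (\<omega> t)) (snd (\<omega> t))) \<in> borel_measurable (process_law \<pi> s\<^sub>0)" for t
    by (rule measurable_compose[OF measurable_process_coordinate[OF pol s0] measurable_cost])
  show ?thesis
    unfolding policy_value_def by (simp add: nn_integral_suminf nn_integral_cmult)
qed

lemma nn_integral_process_one_step: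
  assumes pol: "policy \<pi>" and s0: "s\<^sub>0 \<in> space MS" and w: "w \<in> borel_measurable MS"
  shows "(\<integral>\<^sup>+ \<omega>. (cost (fst (\<omega> t)) (snd (\<omega> t)) + c * (\<integral>\<^sup>+ s. w s \<partial>Q (fst (\<omega> t)) (snd (\<omega> t))))
      \<partial>process_law \<pi> s\<^sub>0) =
    (\<integral>\<^sup>+ \<omega>. cost (fst (\<omega> t)) (snd (\<omega> t)) \<partial>process_law \<pi> s\<^sub>0) +
    c * (\<integral>\<^sup>+ \<omega>. w (fst (\<omega> (Suc t))) \<partial>process_law \<pi> s\<^sub>0)"
proof -
  note X = measurable_process_coordinate[OF pol s0, of t]
  note [measurable] = measurable_compose[OF X measurable_cost]
    measurable_compose[OF X measurable_nn_integral_Q[OF w]]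
  show ?thesis
    unfolding nn_integral_process_state_Suc[OF pol s0 w]
    by (simp add: nn_integral_add nn_integral_cmult)
qed

text \<open>Subsolutions bound every policy from below. The inequality holds for each action
  separately, so it survives averaging over randomized, history-dependent choices; since
  \<open>v 0\<close> vanishes, \<open>m\<close> steps leave a partial sum of the discounted
  costs.\<close>

lemma le_policy_value:
  fixes v :: "nat \<Rightarrow> 'a \<times> nat \<Rightarrow> ennreal"
  assumes pol: "policy \<pi>" and s0: "s\<^sub>0 \<in> space MS" and \<gamma>: "0 \<le> \<gamma>"
    and v: "\<And>m. v m \<in> borel_measurable MS"
    and v0: "\<And>s. v 0 s = 0"
    and step: "\<And>m s a. s \<in> space MS \<Longrightarrow>
      v (Suc m) s \<le> cost s a + ennreal \<gamma> * (\<integral>\<^sup>+ s'. v m s' \<partial>Q s a)"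
  shows "v m s\<^sub>0 \<le> policy_value \<gamma> \<pi> s\<^sub>0"
proof -
  let ?c = "\<lambda>t. \<integral>\<^sup>+ \<omega>. cost (fst (\<omega> t)) (snd (\<omega> t)) \<partial>process_law \<pi> s\<^sub>0"
  \<comment> \<open>The claim ranges over all starting times \<open>t\<close> of one fixed process:
    the induction moves to \<open>Suc t\<close> instead of restarting the process, which a
    history-dependent policy would not permit.\<close>
  have *: "(\<integral>\<^sup>+ \<omega>. v m (fst (\<omega> t)) \<partial>process_law \<pi> s\<^sub>0) \<le> (\<Sum>i<m. ennreal (\<gamma> ^ i) * ?c (t + i))" for t
  proof (induction m arbitrary: t)
    case (Suc m)
    have "(\<integral>\<^sup>+ \<omega>. v (Suc m) (fst (\<omega> t)) \<partial>process_law \<pi> s\<^sub>0) \<le>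
        (\<integral>\<^sup>+ \<omega>. (cost (fst (\<omega> t)) (snd (\<omega> t)) +
          ennreal \<gamma> * (\<integral>\<^sup>+ s. v m s \<partial>Q (fst (\<omega> t)) (snd (\<omega> t)))) \<partial>process_law \<pi> s\<^sub>0)"
      using process_law_space[OF pol s0]
      by (intro nn_integral_mono step) (auto simp: space_pair_measure mem_Times_iff)
    also have "\<dots> = ?c t + ennreal \<gamma> * (\<integral>\<^sup>+ \<omega>. v m (fst (\<omega> (Suc t))) \<partial>process_law \<pi> s\<^sub>0)"
      by (rule nn_integral_process_one_step[OF pol s0 v])
    also have "\<dots> \<le> ?c t + ennreal \<gamma> * (\<Sum>i<m. ennreal (\<gamma> ^ i) * ?c (Suc t + i))"
      by (intro add_left_mono mult_left_mono Suc.IH) simp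
    also have "\<dots> = (\<Sum>i<Suc m. ennreal (\<gamma> ^ i) * ?c (t + i))"
      unfolding sum.lessThan_Suc_shift
      using \<gamma> by (simp add: sum_distrib_left ennreal_mult mult.assoc)
    finally show ?case .
  qed (simp add: v0)
  have "v m s\<^sub>0 \<le> (\<Sum>i<m. ennreal (\<gamma> ^ i) * ?c i)"
    using *[of 0] by (simp add: nn_integral_process_state_0[OF pol s0 v])
  also have "\<dots> \<le> policy_value \<gamma> \<pi> s\<^sub>0"
    unfolding policy_value_suminf[OF pol s0] by (intro sum_le_suminf) auto
  finally show ?thesis .
qed

text \<open>Supersolutions bound a stationary policy from above: unrolling \<open>m\<close> steps
  leaves a nonnegative terminal term, which is dropped.\<close>

lemma policy_value_stationary_le:
  assumes \<phi>[measurable]: "\<phi> \<in> MS \<rightarrow>\<^sub>M MA" and s0: "s\<^sub>0 \<in> space MS" and \<gamma>: "0 \<le> \<gamma>"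
    and w: "w \<in> borel_measurable MS"
    and step: "\<And>s. s \<in> space MS \<Longrightarrow>
      cost s (\<phi> s) + ennreal \<gamma> * (\<integral>\<^sup>+ s'. w s' \<partial>Q s (\<phi> s)) \<le> w s"
  shows "policy_value \<gamma> (stationary \<phi>) s\<^sub>0 \<le> w s\<^sub>0"
proof -
  note pol = policy_stationary[OF \<phi>]
  let ?L = "process_law (stationary \<phi>) s\<^sub>0"
  let ?c = "\<lambda>t. \<integral>\<^sup>+ \<omega>. cost (fst (\<omega> t)) (snd (\<omega> t)) \<partial>?L"
  let ?f = "\<lambda>p. cost (fst p) (snd p) + ennreal \<gamma> * (\<integral>\<^sup>+ s. w s \<partial>Q (fst p) (snd p))"
  have f: "?f \<in> borel_measurable MSA"
    using measurable_nn_integral_Q[OF w] by measurable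
  have *: "(\<Sum>i<m. ennreal (\<gamma> ^ i) * ?c (t + i)) \<le> (\<integral>\<^sup>+ \<omega>. w (fst (\<omega> t)) \<partial>?L)" for m t
  proof (induction m arbitrary: t)
    case (Suc m)
    have "(\<Sum>i<Suc m. ennreal (\<gamma> ^ i) * ?c (t + i)) =
        ?c t + ennreal \<gamma> * (\<Sum>i<m. ennreal (\<gamma> ^ i) * ?c (Suc t + i))"
      unfolding sum.lessThan_Suc_shift
      using \<gamma> by (simp add: sum_distrib_left ennreal_mult mult.assoc)
    also have "\<dots> \<le> ?c t + ennreal \<gamma> * (\<integral>\<^sup>+ \<omega>. w (fst (\<omega> (Suc t))) \<partial>?L)"
      by (intro add_left_mono mult_left_mono Suc.IH) simp
    also have "\<dots> = (\<integral>\<^sup>+ \<omega>. ?f (\<omega> t) \<partial>?L)"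
      by (rule nn_integral_process_one_step[OF pol s0 w, symmetric])
    \<comment> \<open>\<open>step\<close> speaks only of the action chosen by \<open>\<phi>\<close>,
      so the random action has to be replaced by it first.\<close>
    also have "\<dots> = (\<integral>\<^sup>+ \<omega>. ?f (fst (\<omega> t), \<phi> (fst (\<omega> t))) \<partial>?L)"
      by (rule nn_integral_process_stationary[OF \<phi> s0 f])
    also have "\<dots> \<le> (\<integral>\<^sup>+ \<omega>. w (fst (\<omega> t)) \<partial>?L)"
      using process_law_space[OF pol s0]
      by (intro nn_integral_mono) (auto intro!: step simp: space_pair_measure mem_Times_iff)
    finally show ?case .
  qed simp
  have "(\<Sum>i<m. ennreal (\<gamma> ^ i) * ?c i) \<le> w s\<^sub>0" for m
    using *[where t=0 and m=m] by (simp add: nn_integral_process_state_0[OF pol s0 w])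
  then show ?thesis
    unfolding policy_value_suminf[OF pol s0] by (intro suminf_le_const summableI)
qed

subsection \<open>Value iteration\<close>

text \<open>The integrals against \<open>Q\<close> are written out for the two actions, which makes
  monotonicity and continuity of the operator direct.\<close>

definition bellman :: "real \<Rightarrow> ('a \<times> nat \<Rightarrow> ennreal) \<Rightarrow> 'a \<times> nat \<Rightarrow> ennreal" where
  "bellman \<gamma> w s =
     min (cost s NoInt + ennreal \<gamma> * w (fst s, Suc (snd s)))
         (cost s Restart + ennreal \<gamma> * (\<integral>\<^sup>+ z. w (z, 0) \<partial>\<nu>))"

definition value_iteration :: "real \<Rightarrow> nat \<Rightarrow> 'a \<times> nat \<Rightarrow> ennreal" where
  "value_iteration \<gamma> m = (bellman \<gamma> ^^ m) (\<lambda>_. 0)"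

lemma measurable_cost_action: "(\<lambda>s. cost s a) \<in> borel_measurable MS"
  using measurable_compose[OF _ measurable_cost, of "\<lambda>s. (s, a)" MS] by simp

lemma measurable_shift:
  "w \<in> borel_measurable MS \<Longrightarrow> (\<lambda>s. w (fst s, Suc (snd s))) \<in> borel_measurable MS"
  by (rule measurable_compose[of "\<lambda>s. (fst s, Suc (snd s))" MS MS]) measurable

lemma measurable_bellman:
  assumes "w \<in> borel_measurable MS"
  shows "bellman \<gamma> w \<in> borel_measurable MS"
proof -
  note [measurable] = measurable_cost_action measurable_shift[OF assms]
  show ?thesis
    unfolding bellman_def[abs_def] by measurable
qed

lemma bellman_mono: "(\<And>s. w s \<le> w' s) \<Longrightarrow> bellman \<gamma> w s \<le> bellman \<gamma> w' s"
  unfolding bellman_def by (intro min.mono add_left_mono mult_left_mono nn_integral_mono) auto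

text \<open>The limit of value iteration is identified with \<open>opt_value\<close> only on
  \<open>space MS\<close>; the operator never leaves that set.\<close>

lemma bellman_cong:
  assumes "\<And>s. s \<in> space MS \<Longrightarrow> w s = w' s" and "s \<in> space MS"
  shows "bellman \<gamma> w s = bellman \<gamma> w' s"
proof -
  have "(\<integral>\<^sup>+ z. w (z, 0) \<partial>\<nu>) = (\<integral>\<^sup>+ z. w' (z, 0) \<partial>\<nu>)"
    by (intro nn_integral_cong assms(1)) (simp add: nu_space space_MS)
  then show ?thesis
    using assms by (simp add: bellman_def space_MS)
qed

lemma bellman_le:
  assumes "w \<in> borel_measurable MS" and "s \<in> space MS"
  shows "bellman \<gamma> w s \<le> cost s a + ennreal \<gamma> * (\<integral>\<^sup>+ s'. w s' \<partial>Q s a)"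
  by (cases a) (simp_all add: bellman_def nn_integral_Q_NoInt[OF assms] nn_integral_Q_Restart[OF assms(1)])

text \<open>With two actions the minimum is continuous, and monotone convergence handles the
  integral over \<open>\<nu>\<close>.\<close>

lemma bellman_SUP_le:
  assumes inc: "incseq w" and w: "\<And>m. w m \<in> borel_measurable MS"
  shows "bellman \<gamma> (\<lambda>s. SUP m. w m s) s \<le> (SUP m. bellman \<gamma> (w m) s)"
proof (rule LIMSEQ_le_const2)
  have inc_s: "incseq (\<lambda>m. w m s)" for s
    using inc unfolding incseq_def le_fun_def by blast
  have [measurable]: "(\<lambda>z. w m (z, 0)) \<in> borel_measurable \<nu>" for m
    by (rule measurable_compose[OF _ w]) measurable
  have "(\<integral>\<^sup>+ z. (SUP m. w m (z, 0)) \<partial>\<nu>) = (SUP m. \<integral>\<^sup>+ z. w m (z, 0) \<partial>\<nu>)"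
    using inc by (intro nn_integral_monotone_convergence_SUP) (auto simp: incseq_def le_fun_def)
  moreover have "incseq (\<lambda>m. \<integral>\<^sup>+ z. w m (z, 0) \<partial>\<nu>)"
    using inc by (auto simp: incseq_def le_fun_def intro!: nn_integral_mono)
  ultimately have R: "(\<lambda>m. \<integral>\<^sup>+ z. w m (z, 0) \<partial>\<nu>) \<longlonglongrightarrow> (\<integral>\<^sup>+ z. (SUP m. w m (z, 0)) \<partial>\<nu>)"
    using LIMSEQ_SUP[of "\<lambda>m. \<integral>\<^sup>+ z. w m (z, 0) \<partial>\<nu>"] by simp
  show "(\<lambda>m. bellman \<gamma> (w m) s) \<longlonglongrightarrow> bellman \<gamma> (\<lambda>s. SUP m. w m s) s"
    unfolding bellman_def
    by (intro tendsto_min tendsto_add tendsto_const ennreal_tendsto_cmult R LIMSEQ_SUP[OF inc_s]) auto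
  show "\<exists>N. \<forall>n\<ge>N. bellman \<gamma> (w n) s \<le> (SUP m. bellman \<gamma> (w m) s)"
    by (auto intro!: SUP_upper)
qed

lemma value_iteration_Suc: "value_iteration \<gamma> (Suc m) = bellman \<gamma> (value_iteration \<gamma> m)"
  by (simp add: value_iteration_def)

lemma measurable_value_iteration: "value_iteration \<gamma> m \<in> borel_measurable MS"
proof (induction m)
  case 0
  then show ?case
    by (simp add: value_iteration_def)
qed (simp add: value_iteration_Suc measurable_bellman)

lemma incseq_value_iteration: "incseq (value_iteration \<gamma>)"
proof (intro incseq_SucI le_funI)
  show "value_iteration \<gamma> m s \<le> value_iteration \<gamma> (Suc m) s" for m s
  proof (induction m arbitrary: s)
    case 0
    then show ?case
      by (simp add: value_iteration_def)
  next
    case (Suc m)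
    then show ?case
      unfolding value_iteration_Suc by (intro bellman_mono) (simp add: value_iteration_Suc)
  qed
qed

lemma bellman_SUP_value_iteration:
  "bellman \<gamma> (\<lambda>s. SUP m. value_iteration \<gamma> m s) s \<le> (SUP m. value_iteration \<gamma> m s)"
proof -
  have "bellman \<gamma> (\<lambda>s. SUP m. value_iteration \<gamma> m s) s \<le> (SUP m. value_iteration \<gamma> (Suc m) s)"
    unfolding value_iteration_Suc
    by (rule bellman_SUP_le[OF incseq_value_iteration measurable_value_iteration])
  also have "\<dots> \<le> (SUP m. value_iteration \<gamma> m s)"
    by (rule SUP_mono) blast
  finally show ?thesis .
qed

lemma opt_value_eq_SUP_value_iteration:
  assumes \<gamma>: "0 \<le> \<gamma>" and s: "s \<in> space MS"
  shows "opt_value \<gamma> s = (SUP m. value_iteration \<gamma> m s)"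
proof (rule antisym)
  let ?v = "\<lambda>s. SUP m. value_iteration \<gamma> m s"
  note v_measurable = measurable_value_iteration
  have v[measurable]: "?v \<in> borel_measurable MS"
    by (rule borel_measurable_SUP) (auto intro: v_measurable)
  \<comment> \<open>The greedy rule for \<open>?v\<close>: it attains the minimum in
    \<open>bellman\<close> and is measurable because it compares two measurable functions.\<close>
  define \<phi> where "\<phi> s =
    (if cost s NoInt + ennreal \<gamma> * ?v (fst s, Suc (snd s)) \<le>
        cost s Restart + ennreal \<gamma> * (\<integral>\<^sup>+ z. ?v (z, 0) \<partial>\<nu>) then NoInt else Restart)" for s
  note [measurable] = measurable_cost_action measurable_shift[OF v]
  have \<phi>: "\<phi> \<in> MS \<rightarrow>\<^sub>M MA"
    unfolding \<phi>_def[abs_def] by measurable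
  have "policy_value \<gamma> (stationary \<phi>) s \<le> ?v s"
  proof (rule policy_value_stationary_le[OF \<phi> s \<gamma> v])
    fix s' assume s': "s' \<in> space MS"
    have "cost s' (\<phi> s') + ennreal \<gamma> * (\<integral>\<^sup>+ t. ?v t \<partial>Q s' (\<phi> s')) = bellman \<gamma> ?v s'"
      unfolding \<phi>_def bellman_def
      by (auto simp: nn_integral_Q_NoInt[OF v s'] nn_integral_Q_Restart[OF v] min_def)
    then show "cost s' (\<phi> s') + ennreal \<gamma> * (\<integral>\<^sup>+ t. ?v t \<partial>Q s' (\<phi> s')) \<le> ?v s'"
      using bellman_SUP_value_iteration by simp
  qed
  then show "opt_value \<gamma> s \<le> ?v s"
    unfolding opt_value_def using policy_stationary[OF \<phi>] by (intro INF_lower2[of "stationary \<phi>"]) auto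
  have "value_iteration \<gamma> m s \<le> policy_value \<gamma> \<pi> s" if "policy \<pi>" for m \<pi>
  proof (rule le_policy_value[OF that s \<gamma> v_measurable])
    show "value_iteration \<gamma> 0 t = 0" for t
      by (simp add: value_iteration_def)
  qed (unfold value_iteration_Suc, rule bellman_le[OF v_measurable])
  then show "?v s \<le> opt_value \<gamma> s"
    unfolding opt_value_def by (intro SUP_least INF_greatest) auto
qed

text \<open>The holding cost \<open>PF k x\<close> is common to both actions and leaves the minimum,
  so what remains is exactly the comparison made in \<open>threshold\<close>.\<close>

lemma opt_value_ge:
  assumes "0 \<le> \<gamma>" and x: "x \<in> X"
  shows "PF k x + min (ennreal (G NoInt) + ennreal \<gamma> * opt_value \<gamma> (x, Suc k)) (restart_value \<gamma>)
    \<le> opt_value \<gamma> (x, k)"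
proof -
  have s: "(x, k) \<in> space MS"
    using x by (simp add: space_MS)
  have "bellman \<gamma> (opt_value \<gamma>) (x, k) = bellman \<gamma> (\<lambda>s. SUP m. value_iteration \<gamma> m s) (x, k)"
    by (rule bellman_cong[OF opt_value_eq_SUP_value_iteration[OF assms(1)] s])
  also have "\<dots> \<le> opt_value \<gamma> (x, k)"
    unfolding opt_value_eq_SUP_value_iteration[OF assms(1) s] by (rule bellman_SUP_value_iteration)
  finally have *: "bellman \<gamma> (opt_value \<gamma>) (x, k) \<le> opt_value \<gamma> (x, k)" .
  have "mono ((+) (PF k x))"
    by (intro monoI add_left_mono)
  from min_of_mono[OF this] * show ?thesis
    by (simp add: bellman_def cost_def restart_value_def add.assoc)
qed

subsection \<open>Never restarting\<close>

lemma PF_mono: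
  assumes F: "\<And>x. x \<in> X \<Longrightarrow> F x \<le> (\<integral>\<^sup>+ y. F y \<partial>P x)" and x: "x \<in> X"
  shows "incseq (\<lambda>k. PF k x)"
proof (rule incseq_SucI)
  show "PF k x \<le> PF (Suc k) x" for k
    unfolding PF_Suc[OF x] unfolding PF_def
    by (intro nn_integral_mono F) (simp add: kernel_pow_space[OF x])
qed

text \<open>The function \<open>U\<close> of the overview, given as a series so that its recursion
  is an index shift.\<close>

definition no_int_value :: "real \<Rightarrow> 'a \<times> nat \<Rightarrow> ennreal" where
  "no_int_value \<gamma> s = (\<Sum>t. ennreal (\<gamma> ^ t) * (PF (snd s + t) (fst s) + ennreal (G NoInt)))"

lemma no_int_value_rec:
  assumes "0 \<le> \<gamma>"
  shows "no_int_value \<gamma> (x, k) =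
    PF k x + ennreal (G NoInt) + ennreal \<gamma> * no_int_value \<gamma> (x, Suc k)"
proof -
  let ?f = "\<lambda>t. ennreal (\<gamma> ^ t) * (PF (k + t) x + ennreal (G NoInt))"
  have "no_int_value \<gamma> (x, k) = (\<Sum>t. ?f (t + 1)) + sum ?f {..<1}"
    unfolding no_int_value_def fst_conv snd_conv by (rule suminf_offset) simp
  also have "(\<Sum>t. ?f (t + 1)) = ennreal \<gamma> * no_int_value \<gamma> (x, Suc k)"
    unfolding no_int_value_def fst_conv snd_conv ennreal_suminf_cmult[symmetric]
    using assms by (simp add: ennreal_mult mult.assoc)
  finally show ?thesis
    by (simp add: add.commute)
qed

lemma measurable_no_int_value: "no_int_value \<gamma> \<in> borel_measurable MS"
proof -
  have [measurable]: "(\<lambda>s. PF (snd s + t) (fst s)) \<in> borel_measurable MS" for t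
  proof (rule measurable_compose_countable[of "\<lambda>k s. PF (k + t) (fst s)" MS borel snd])
    show "(\<lambda>s. PF (k + t) (fst s)) \<in> borel_measurable MS" for k
      by (rule measurable_compose[OF measurable_fst measurable_PF])
  qed measurable
  show ?thesis
    unfolding no_int_value_def[abs_def] by measurable
qed

lemma policy_value_no_int_le:
  assumes "0 \<le> \<gamma>" and s: "s \<in> space MS"
  shows "policy_value \<gamma> (stationary (\<lambda>_. NoInt)) s \<le> no_int_value \<gamma> s"
proof (rule policy_value_stationary_le[OF _ s assms(1) measurable_no_int_value])
  fix s' assume s': "s' \<in> space MS"
  show "cost s' NoInt + ennreal \<gamma> * (\<integral>\<^sup>+ t. no_int_value \<gamma> t \<partial>Q s' NoInt) \<le> no_int_value \<gamma> s'"
    using no_int_value_rec[OF assms(1), of "fst s'" "snd s'"]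
    by (simp add: nn_integral_Q_NoInt[OF measurable_no_int_value s'] cost_def)
qed simp

lemma opt_value_le_no_int_value:
  assumes "0 \<le> \<gamma>" and s: "s \<in> space MS"
  shows "opt_value \<gamma> s \<le> no_int_value \<gamma> s"
proof -
  have "policy (stationary (\<lambda>_. NoInt))"
    by (rule policy_stationary) simp
  then have "opt_value \<gamma> s \<le> policy_value \<gamma> (stationary (\<lambda>_. NoInt)) s"
    unfolding opt_value_def by (intro INF_lower) simp
  also have "\<dots> \<le> no_int_value \<gamma> s"
    by (rule policy_value_no_int_le[OF assms])
  finally show ?thesis .
qed

text \<open>Both sides follow the same one-step recursion along the orbit of \<open>y\<close>, so
  each step multiplies the possible excess by \<gamma>, starting from \<open>M\<close>. The
  hypotheses concern a single \<open>y\<close>: the lemma serves first for the given point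
  \<open>x\<close> and then for every point.\<close>

lemma no_int_value_le_opt_value:
  fixes M :: real
  assumes \<gamma>: "0 \<le> \<gamma>" "\<gamma> < 1" and y: "y \<in> X"
    and bound: "\<And>k. no_int_value \<gamma> (y, k) \<le> ennreal M"
    and no_restart: "\<And>k. ennreal (G NoInt) + ennreal \<gamma> * opt_value \<gamma> (y, Suc k) \<le> restart_value \<gamma>"
  shows "no_int_value \<gamma> (y, k) \<le> opt_value \<gamma> (y, k)"
proof (rule ennreal_le_if_le_add_geometric[OF \<gamma>])
  show "no_int_value \<gamma> (y, k) \<le> opt_value \<gamma> (y, k) + ennreal (M * \<gamma> ^ m)" for m
  proof (induction m arbitrary: k)
    case 0
    show ?case
      using bound[of k] by (simp add: add_increasing)
  next
    case (Suc m)
    have e: "ennreal (M * \<gamma> ^ Suc m) = ennreal \<gamma> * ennreal (M * \<gamma> ^ m)"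
      by (simp only: ennreal_mult'[OF \<gamma>(1), symmetric] power_Suc mult.left_commute[of M])
    have "no_int_value \<gamma> (y, k) \<le> PF k y + ennreal (G NoInt) +
        ennreal \<gamma> * (opt_value \<gamma> (y, Suc k) + ennreal (M * \<gamma> ^ m))"
      by (subst no_int_value_rec[OF \<gamma>(1)]) (intro add_left_mono mult_left_mono Suc.IH; simp)
    also have "\<dots> = (PF k y + (ennreal (G NoInt) + ennreal \<gamma> * opt_value \<gamma> (y, Suc k))) +
        ennreal (M * \<gamma> ^ Suc m)"
      unfolding e by (simp add: distrib_left add.assoc)
    also have "\<dots> \<le> opt_value \<gamma> (y, k) + ennreal (M * \<gamma> ^ Suc m)"
      \<comment> \<open>By \<open>no_restart\<close> the minimum in \<open>opt_value_ge\<close> is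
        its continuing branch.\<close>
      using opt_value_ge[OF \<gamma>(1) y, of k] no_restart[of k]
      by (intro add_right_mono) (simp add: min_absorb1)
    finally show ?case .
  qed
qed

end

theorem lemma3:
  fixes X :: "'a::polish_space set"
    and P :: "'a \<Rightarrow> 'a measure"
    and \<nu> :: "'a measure"
    and F :: "'a \<Rightarrow> ennreal"
    and G :: "action \<Rightarrow> real"
    and L C \<rho> \<gamma> :: real
  assumes "restart_mdp X P \<nu> F G"
    and "\<forall>x\<in>X. (\<integral>\<^sup>+ y. F y \<partial>P x) \<ge> F x"
    and "0 < \<rho>" and "\<rho> < 1"
    and "\<forall>t::nat. (SUP x\<in>X. \<bar>enn2ereal (restart_mdp.PF X P F t x) - ereal L\<bar>) \<le> ereal (C * \<rho> ^ t)"
    and "0 < \<gamma>" and "\<gamma> < 1"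
    and "\<exists>x\<in>X. restart_mdp.threshold X P \<nu> F G \<gamma> x = \<infinity>"
  shows "\<forall>y\<in>X. \<forall>k::nat.
    restart_mdp.policy_value X P \<nu> F G \<gamma> (restart_mdp.stationary (\<lambda>_. NoInt)) (y, k)
      = restart_mdp.opt_value X P \<nu> F G \<gamma> (y, k)"
proof -
  interpret restart_mdp X P \<nu> F G
    by fact
  have \<gamma>: "0 \<le> \<gamma>" "\<gamma> < 1"
    using assms by auto
  have near_L: "PF t x \<le> ennreal (L + C * \<rho> ^ t)" "ennreal L \<le> PF t x + ennreal (C * \<rho> ^ t)"
    if x: "x \<in> X" for t x
  proof -
    have "\<bar>enn2ereal (PF t x) - ereal L\<bar> \<le> (SUP x\<in>X. \<bar>enn2ereal (PF t x) - ereal L\<bar>)"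
      using x by (rule SUP_upper)
    then have *: "\<bar>enn2ereal (PF t x) - ereal L\<bar> \<le> ereal (C * \<rho> ^ t)"
      using assms(5) order.trans by blast
    \<comment> \<open>An infinite value would lie at infinite distance from
      \<open>L\<close>.\<close>
    then obtain p where p: "PF t x = ennreal p" "0 \<le> p"
      by (cases "PF t x") auto
    with * have "\<bar>p - L\<bar> \<le> C * \<rho> ^ t"
      by simp
    then show "PF t x \<le> ennreal (L + C * \<rho> ^ t)" "ennreal L \<le> PF t x + ennreal (C * \<rho> ^ t)"
      using p by (auto simp: ennreal_plus[symmetric] simp del: ennreal_plus intro!: ennreal_leI)
  qed
  have inc: "incseq (\<lambda>k. PF k x)" if "x \<in> X" for x
    using assms(2) that by (intro PF_mono) auto
  \<comment> \<open>An increasing sequence stays below its limit: compare with index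
    \<open>k + m\<close> and let \<open>m\<close> grow.\<close>
  have PF_le: "PF k y \<le> ennreal L" if y: "y \<in> X" for y k
  proof (rule ennreal_le_if_le_add_geometric)
    fix m
    have "PF k y \<le> PF (k + m) y"
      using inc[OF y] by (rule incseqD) simp
    also have "\<dots> \<le> ennreal (L + C * \<rho> ^ k * \<rho> ^ m)"
      using near_L(1)[OF y, of "k + m"] by (simp add: power_add mult.assoc)
    also have "\<dots> \<le> ennreal L + ennreal (C * \<rho> ^ k * \<rho> ^ m)"
      by (rule ennreal_add_le)
    finally show "PF k y \<le> ennreal L + ennreal (C * \<rho> ^ k * \<rho> ^ m)" .
  qed (use assms in auto)
  \<comment> \<open>\<open>max L 0\<close> makes the numerator nonnegative, and
    \<open>ennreal\<close> maps it to \<open>ennreal L\<close>.\<close>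
  define M where "M = (max L 0 + G NoInt) / (1 - \<gamma>)"
  have U_le: "no_int_value \<gamma> (y, k) \<le> ennreal M" if y: "y \<in> X" for y k
  proof -
    have "no_int_value \<gamma> (y, k) \<le> (\<Sum>t. ennreal (\<gamma> ^ t) * ennreal (max L 0 + G NoInt))"
      unfolding no_int_value_def
      using PF_le[OF y] G_nonneg
      by (intro suminf_le mult_left_mono) (auto simp: ennreal_max_0)
    then show ?thesis
      using suminf_geometric_ennreal[OF \<gamma>, of "max L 0 + G NoInt"] G_nonneg by (simp add: M_def)
  qed
  obtain x where x: "x \<in> X" and "threshold \<gamma> x = \<infinity>"
    using assms(8) by blast
  \<comment> \<open>Any \<open>k\<close> violating this would belong to the set whose infimum is
    \<open>threshold\<close>, making it finite.\<close>
  have less: "ennreal (G NoInt) + ennreal \<gamma> * opt_value \<gamma> (x, Suc k) \<le> restart_value \<gamma>" for k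
  proof (rule ccontr)
    assume "\<not> ?thesis"
    then have "threshold \<gamma> x \<le> enat k"
      unfolding threshold_def by (intro Inf_lower imageI) auto
    then show False
      using \<open>threshold \<gamma> x = \<infinity>\<close> by simp
  qed
  have Ux: "no_int_value \<gamma> (x, k) \<le> opt_value \<gamma> (x, k)" for k
    by (rule no_int_value_le_opt_value[OF \<gamma> x U_le[OF x] less])
  have restart: "ennreal (G NoInt) + ennreal \<gamma> * ennreal M \<le> restart_value \<gamma>"
  proof (rule ennreal_le_if_le_add_geometric)
    fix m
    \<comment> \<open>The discounted total of a constant error
      \<open>max C 0 * \<rho> ^ Suc m\<close>, times the \<gamma> in front of the value. The index
      is \<open>Suc m\<close> because \<open>less\<close> compares the value one step ahead.\<close>
    let ?e = "\<gamma> * (max C 0 * \<rho> ^ Suc m / (1 - \<gamma>))"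
    have pos: "0 \<le> max C 0 * \<rho> ^ Suc m"
      using assms by simp
    have "ennreal M = (\<Sum>t. ennreal (\<gamma> ^ t) * ennreal (max L 0 + G NoInt))"
      using suminf_geometric_ennreal[OF \<gamma>, of "max L 0 + G NoInt"] G_nonneg by (simp add: M_def)
    also have "\<dots> \<le> (\<Sum>t. ennreal (\<gamma> ^ t) * (PF (Suc m + t) x + ennreal (G NoInt)) +
        ennreal (\<gamma> ^ t) * ennreal (max C 0 * \<rho> ^ Suc m))"
    proof (intro suminf_le)
      fix t
      have "ennreal L \<le> PF (Suc m) x + ennreal (C * \<rho> ^ Suc m)"
        by (rule near_L(2)[OF x])
      \<comment> \<open>Monotonicity in time carries the error at \<open>Suc m\<close> to all later
        times, uniformly in \<open>t\<close>, so it sums as a geometric series.\<close>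
      also have "\<dots> \<le> PF (Suc m + t) x + ennreal (max C 0 * \<rho> ^ Suc m)"
        using assms(3) incseqD[OF inc[OF x], of "Suc m" "Suc m + t"]
        by (intro add_mono ennreal_leI mult_right_mono) auto
      finally have "ennreal (max L 0 + G NoInt) \<le>
          (PF (Suc m + t) x + ennreal (max C 0 * \<rho> ^ Suc m)) + ennreal (G NoInt)"
        using G_nonneg by (auto simp: ennreal_max_0 intro: add_right_mono)
      then have "ennreal (\<gamma> ^ t) * ennreal (max L 0 + G NoInt) \<le>
          ennreal (\<gamma> ^ t) * ((PF (Suc m + t) x + ennreal (max C 0 * \<rho> ^ Suc m)) + ennreal (G NoInt))"
        by (rule mult_left_mono) simp
      also have "\<dots> = ennreal (\<gamma> ^ t) * (PF (Suc m + t) x + ennreal (G NoInt)) +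
          ennreal (\<gamma> ^ t) * ennreal (max C 0 * \<rho> ^ Suc m)"
        by (simp only: distrib_left add.assoc add.commute[of "ennreal (\<gamma> ^ t) * ennreal (G NoInt)"])
      finally show "ennreal (\<gamma> ^ t) * ennreal (max L 0 + G NoInt) \<le> \<dots>" .
    qed auto
    also have "\<dots> = no_int_value \<gamma> (x, Suc m) + ennreal (max C 0 * \<rho> ^ Suc m / (1 - \<gamma>))"
      unfolding no_int_value_def suminf_geometric_ennreal[OF \<gamma> pos, symmetric] fst_conv snd_conv
      by (rule suminf_add[symmetric]) auto
    also have "\<dots> \<le> opt_value \<gamma> (x, Suc m) + ennreal (max C 0 * \<rho> ^ Suc m / (1 - \<gamma>))"
      by (intro add_right_mono Ux)
    finally have "ennreal (G NoInt) + ennreal \<gamma> * ennreal M \<le> ennreal (G NoInt) +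
        ennreal \<gamma> * (opt_value \<gamma> (x, Suc m) + ennreal (max C 0 * \<rho> ^ Suc m / (1 - \<gamma>)))"
      by (intro add_left_mono mult_left_mono) simp_all
    also have "\<dots> = ennreal (G NoInt) + ennreal \<gamma> * opt_value \<gamma> (x, Suc m) + ennreal ?e"
      by (simp only: distrib_left ennreal_mult'[OF \<gamma>(1)] add.assoc)
    also have "\<dots> \<le> restart_value \<gamma> + ennreal ?e"
      by (intro add_right_mono less)
    finally show "ennreal (G NoInt) + ennreal \<gamma> * ennreal M \<le>
        restart_value \<gamma> + ennreal ((\<gamma> * max C 0 * \<rho> / (1 - \<gamma>)) * \<rho> ^ m)"
      by (simp add: mult.assoc)
  qed (use assms in auto)
  show ?thesis
  proof (intro ballI allI antisym)
    fix y k assume y: "y \<in> X"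
    then have s: "(y, j) \<in> space MS" for j
      by (simp add: space_MS)
    \<comment> \<open>The restart value does not depend on the state, so the lower bound obtained
      along \<open>x\<close> applies to every \<open>y\<close>.\<close>
    have "ennreal (G NoInt) + ennreal \<gamma> * opt_value \<gamma> (y, Suc j) \<le> restart_value \<gamma>" for j
    proof -
      have "opt_value \<gamma> (y, Suc j) \<le> ennreal M"
        using opt_value_le_no_int_value[OF \<gamma>(1) s] U_le[OF y] order.trans by blast
      then have "ennreal (G NoInt) + ennreal \<gamma> * opt_value \<gamma> (y, Suc j) \<le>
          ennreal (G NoInt) + ennreal \<gamma> * ennreal M"
        by (intro add_left_mono mult_left_mono) simp_all
      then show ?thesis
        using restart by (rule order.trans)
    qed
    then have "no_int_value \<gamma> (y, k) \<le> opt_value \<gamma> (y, k)"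
      by (rule no_int_value_le_opt_value[OF \<gamma> y U_le[OF y]])
    then show "policy_value \<gamma> (stationary (\<lambda>_. NoInt)) (y, k) \<le> opt_value \<gamma> (y, k)"
      using policy_value_no_int_le[OF \<gamma>(1) s] order.trans by blast
    have "policy (stationary (\<lambda>_. NoInt))"
      by (rule policy_stationary) simp
    then show "opt_value \<gamma> (y, k) \<le> policy_value \<gamma> (stationary (\<lambda>_. NoInt)) (y, k)"
      unfolding opt_value_def by (intro INF_lower) simp
  qed
qed

end
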